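(* Let $n\ge 3$, and let $(A_{ij})_{1\le i<j\le n}$ be generated from the sparse $\beta$-model with true parameter $(\mu_0,\boldsymbol\beta_0)$. Let $S=S(\boldsymbol\beta_0)=\{i:\beta_{0i}\ne0\}$ and let $S^c$ be its complement in $\{1,\dots,n\}$. Pick any $\tau\in(0,1)$. Suppose that the following $\beta$-min condition is satisfied: $$\min_{i\in S}\beta_{0i}>\log\left(1+c_{n,\tau/(n(n-1))}\,(1+e^{\mu^-})(1+e^{2\overline\beta+\mu^+})\right),$$ where $c_{n,t}=\sqrt{\frac{2}{n-2}\log(2/t)}$ for $t\in(0,1)$, $\overline\beta=\max_{1\le k\le n}\beta_{0k}$, $\mu^+=\max\{\mu_0,0\}$ and $\mu^-=\max\{-\mu_0,0\}$. Then $\min_{i\in S}d_i>\max_{j\in S^c}d_j$ with probability at least $1-\tau$.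
   Context: Sparse $\beta$-model with parameter $(\mu,\boldsymbol\beta)$: an undirected random graph on $\{1,\dots,n\}$ without self-loops with symmetric adjacency matrix $A$, where $(A_{ij})_{i<j}$ are independent Bernoulli random variables with $P(A_{ij}=1)=e^{\mu+\beta_i+\beta_j}/(1+e^{\mu+\beta_i+\beta_j})$, $\mu\in\mathbb R$, $\boldsymbol\beta\in[0,\infty)^n$, $\min_{1\le i\le n}\beta_i=0$. The degree of node $i$ is $d_i=\sum_{j\ne i}A_{ij}$. *)

theory Defs
  imports "HOL-Probability.Probability"
begin

definition edge_prob :: "real \<Rightarrow> (nat \<Rightarrow> real) \<Rightarrow> nat \<Rightarrow> nat \<Rightarrow> real" where
  "edge_prob \<mu> \<beta> i j = exp (\<mu> + \<beta> i + \<beta> j) / (1 + exp (\<mu> + \<beta> i + \<beta> j))"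

text \<open>Nodes are the numbers \<open>1, \<dots>, n\<close>; the values of \<open>\<beta>\<close> and \<open>A\<close> outside this range are
  irrelevant. Measurability of the entries above the diagonal is part of \<open>indep_vars\<close>.\<close>

locale sparse_beta_model = prob_space M
  for M :: "'a measure" and n :: nat and \<mu> :: real and \<beta> :: "nat \<Rightarrow> real"
    and A :: "nat \<Rightarrow> nat \<Rightarrow> 'a \<Rightarrow> nat" +
  assumes beta_nonneg: "\<And>i. i \<in> {1..n} \<Longrightarrow> 0 \<le> \<beta> i"
    and beta_Min: "Min (\<beta> ` {1..n}) = 0"
    and adj_binary: "\<And>i j \<omega>. \<lbrakk>i \<in> {1..n}; j \<in> {1..n}; \<omega> \<in> space M\<rbrakk> \<Longrightarrow> A i j \<omega> \<in> {0, 1}"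
    and adj_sym: "\<And>i j \<omega>. \<lbrakk>i \<in> {1..n}; j \<in> {1..n}; \<omega> \<in> space M\<rbrakk> \<Longrightarrow> A i j \<omega> = A j i \<omega>"
    and adj_no_loop: "\<And>i \<omega>. \<lbrakk>i \<in> {1..n}; \<omega> \<in> space M\<rbrakk> \<Longrightarrow> A i i \<omega> = 0"
    and adj_indep: "indep_vars (\<lambda>_. count_space UNIV) (\<lambda>(i, j). A i j)
          {(i, j). 1 \<le> i \<and> i < j \<and> j \<le> n}"
    and adj_prob: "\<And>i j. \<lbrakk>1 \<le> i; i < j; j \<le> n\<rbrakk> \<Longrightarrow>
          \<P>(\<omega> in M. A i j \<omega> = 1) = edge_prob \<mu> \<beta> i j"

definition node_degree :: "nat \<Rightarrow> (nat \<Rightarrow> nat \<Rightarrow> 'a \<Rightarrow> nat) \<Rightarrow> nat \<Rightarrow> 'a \<Rightarrow> nat" where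
  "node_degree n A i \<omega> = (\<Sum>j \<in> {1..n} - {i}. A i j \<omega>)"

definition beta_support :: "nat \<Rightarrow> (nat \<Rightarrow> real) \<Rightarrow> nat set" where
  "beta_support n \<beta> = {i \<in> {1..n}. \<beta> i \<noteq> 0}"

definition c_const :: "nat \<Rightarrow> real \<Rightarrow> real" where
  "c_const n t = sqrt (2 / (real n - 2) * ln (2 / t))"

text \<open>The set of nonzero coordinates may be empty, so the minimum over it is taken as an infimum in
  the extended numbers: it is the ordinary minimum for a nonempty finite set, and \<open>\<infinity>\<close> for the
  empty set.\<close>

definition min_beta :: "(nat \<Rightarrow> real) \<Rightarrow> nat set \<Rightarrow> ereal" where
  "min_beta \<beta> S = (INF i\<in>S. ereal (\<beta> i))"

definition min_degree :: "nat \<Rightarrow> (nat \<Rightarrow> nat \<Rightarrow> 'a \<Rightarrow> nat) \<Rightarrow> nat set \<Rightarrow> 'a \<Rightarrow> enat" where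
  "min_degree n A S \<omega> = (INF i\<in>S. enat (node_degree n A i \<omega>))"

lemma min_beta_eq_Min:
  assumes "finite S" "S \<noteq> {}"
  shows "min_beta \<beta> S = ereal (Min (\<beta> ` S))"
proof -
  have "min_beta \<beta> S = Min ((\<lambda>i. ereal (\<beta> i)) ` S)"
    using assms by (simp add: min_beta_def Min_Inf)
  also have "\<dots> = ereal (Min (\<beta> ` S))"
    using mono_Min_commute[of ereal "\<beta> ` S"] assms by (simp add: image_image mono_def)
  finally show ?thesis .
qed

lemma min_degree_eq_Min:
  assumes "finite S" "S \<noteq> {}"
  shows "min_degree n A S \<omega> = enat (Min ((\<lambda>i. node_degree n A i \<omega>) ` S))"
proof -
  have "min_degree n A S \<omega> = Min ((\<lambda>i. enat (node_degree n A i \<omega>)) ` S)"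
    using assms by (simp add: min_degree_def Min_Inf)
  also have "\<dots> = enat (Min ((\<lambda>i. node_degree n A i \<omega>) ` S))"
    using mono_Min_commute[of enat "(\<lambda>i. node_degree n A i \<omega>) ` S"] assms
    by (simp add: image_image mono_def)
  finally show ?thesis .
qed

end

theory Submission imports Defs begin

text \<open>
  Why the theorem holds. Fix a node \<open>i\<close> in the support and a node \<open>j\<close> outside it. The edge between
  \<open>i\<close> and \<open>j\<close> contributes equally to both degrees, so \<open>d\<^sub>i - d\<^sub>j\<close> is the sum over the \<open>n - 2\<close> other
  nodes \<open>k\<close> of \<open>A i k - A j k\<close>. These \<open>2 (n - 2)\<close> entries sit on distinct edges, hence are
  independent, and Hoeffding's inequality applies: if every \<open>k\<close> satisfies
  \<open>p\<^sub>i\<^sub>k - p\<^sub>j\<^sub>k \<ge> \<delta>\<close>, then \<open>d\<^sub>i \<le> d\<^sub>j\<close> has probability at most \<open>exp (- (n - 2) \<delta>\<^sup>2)\<close>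
  (\<open>prob_degree_le\<close>).

  The condition on \<open>\<beta>\<^sub>i\<close> is the one that makes \<open>\<delta> = c\<^sub>n\<^sub>,\<^sub>t\<close> admissible for
  \<open>t = \<tau> / (n (n - 1))\<close>: since \<open>\<beta>\<^sub>j = 0\<close>, the gap \<open>p\<^sub>i\<^sub>k - p\<^sub>j\<^sub>k\<close> is a difference of two values of the
  logistic function at points that differ by \<open>\<beta>\<^sub>i\<close>, and it factors as a numerator
  \<open>exp \<beta>\<^sub>i - 1\<close> over two factors that are bounded in terms of \<open>\<mu>\<close> and the maximum of \<open>\<beta>\<close>
  (\<open>edge_prob_gap\<close>). With this \<open>\<delta>\<close> the Hoeffding bound is \<open>(t / 2)\<^sup>2 \<le> t\<close>, and a union bound over
  the at most \<open>n (n - 1)\<close> pairs \<open>(i, j)\<close> gives total failure probability at most \<open>\<tau>\<close>.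
\<close>

section \<open>Edge probabilities\<close>

lemma edge_prob_commute: "edge_prob \<mu> \<beta> i j = edge_prob \<mu> \<beta> j i"
  by (simp add: edge_prob_def add_ac)

lemma logistic_diff:
  fixes x b :: real
  shows "exp (x + b) / (1 + exp (x + b)) - exp x / (1 + exp x) =
    (exp b - 1) / ((1 + exp (- x)) * (1 + exp (x + b)))"
proof -
  define u v where "u = exp x" and "v = exp b"
  have "u > 0" "v > 0" by (simp_all add: u_def v_def)
  have "1 + u * v > 0" "1 + u > 0" using \<open>u > 0\<close> \<open>v > 0\<close> by (simp_all add: add_pos_pos)
  then have "u * v / (1 + u * v) - u / (1 + u) = (v - 1) / ((1 + 1 / u) * (1 + u * v))"
    using \<open>u > 0\<close> by (simp add: divide_simps) (simp add: algebra_simps)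
  then show ?thesis by (simp add: exp_add exp_minus u_def v_def inverse_eq_divide)
qed

text \<open>Raising one endpoint's parameter from \<open>0\<close> to \<open>\<beta> i\<close> moves the edge probability by a definite
  amount as long as the other parameters keep the edge away from being almost certainly absent (the
  factor with \<open>\<mu>\<^sup>-\<close>) or almost certainly present (the factor with \<open>2 B + \<mu>\<^sup>+\<close>).\<close>

lemma edge_prob_gap:
  assumes "\<beta> j = 0" "0 \<le> \<beta> k" "\<beta> k \<le> B" "\<beta> i \<le> B" "0 \<le> \<delta>"
    and gap: "ln (1 + \<delta> * (1 + exp (max (- \<mu>) 0)) * (1 + exp (2 * B + max \<mu> 0))) < \<beta> i"
  shows "\<delta> \<le> edge_prob \<mu> \<beta> i k - edge_prob \<mu> \<beta> j k"
proof -
  let ?C = "(1 + exp (max (- \<mu>) 0)) * (1 + exp (2 * B + max \<mu> 0))"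
  let ?D = "(1 + exp (- (\<mu> + \<beta> k))) * (1 + exp (\<mu> + \<beta> k + \<beta> i))"
  have "0 \<le> \<delta> * ?C" using \<open>0 \<le> \<delta>\<close> by (simp add: add_nonneg_nonneg)
  then have C: "\<delta> * ?C < exp (\<beta> i) - 1"
    using gap exp_less_mono[OF gap] by (simp add: mult.assoc)
  have "?D \<le> ?C"
    using assms by (intro mult_mono add_left_mono) (auto simp: add_nonneg_nonneg)
  then have "\<delta> * ?D \<le> \<delta> * ?C" using \<open>0 \<le> \<delta>\<close> by (intro mult_left_mono)
  moreover have "?D > 0" by (simp add: add_pos_pos)
  ultimately have "\<delta> \<le> (exp (\<beta> i) - 1) / ?D"
    using C by (subst pos_le_divide_eq) auto
  also have "\<dots> = edge_prob \<mu> \<beta> i k - edge_prob \<mu> \<beta> j k"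
    using logistic_diff[of "\<mu> + \<beta> k" "\<beta> i"] \<open>\<beta> j = 0\<close> by (simp add: edge_prob_def add_ac)
  finally show ?thesis .
qed

section \<open>Entries of the adjacency matrix\<close>

context sparse_beta_model
begin

lemma adj_measurable:
  assumes "i \<in> {1..n}" "j \<in> {1..n}"
  shows "A i j \<in> measurable M (count_space UNIV)"
proof -
  have upper: "A k l \<in> measurable M (count_space UNIV)" if "1 \<le> k" "k < l" "l \<le> n" for k l
    using adj_indep that unfolding indep_vars_def by auto
  consider "i < j" | "i = j" | "j < i" by linarith
  then show ?thesis
  proof cases
    case 1
    then show ?thesis using upper assms by simp
  next
    case 2
    then show ?thesis
      using adj_no_loop[OF assms(1)] by (simp cong: measurable_cong)
  next
    case 3
    then have "A j i \<in> measurable M (count_space UNIV)" using upper assms by simp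
    then show ?thesis
      using adj_sym[OF assms] by (simp cong: measurable_cong)
  qed
qed

lemma prob_adj:
  assumes "i \<in> {1..n}" "j \<in> {1..n}" "i \<noteq> j"
  shows "\<P>(\<omega> in M. A i j \<omega> = 1) = edge_prob \<mu> \<beta> i j"
proof (cases "i < j")
  case True
  then show ?thesis using adj_prob assms by simp
next
  case False
  have "{\<omega> \<in> space M. A i j \<omega> = 1} = {\<omega> \<in> space M. A j i \<omega> = 1}"
    using adj_sym[OF assms(1,2)] by auto
  then show ?thesis using adj_prob[of j i] assms False by (simp add: edge_prob_commute)
qed

lemma expectation_adj:
  assumes "i \<in> {1..n}" "j \<in> {1..n}" "i \<noteq> j"
  shows "expectation (\<lambda>\<omega>. real (A i j \<omega>)) = edge_prob \<mu> \<beta> i j"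
proof -
  have [measurable]: "A i j \<in> measurable M (count_space UNIV)"
    using assms by (intro adj_measurable)
  have "expectation (\<lambda>\<omega>. real (A i j \<omega>)) =
      expectation (indicator {\<omega> \<in> space M. A i j \<omega> = 1})"
    using adj_binary[OF assms(1,2)]
    by (intro Bochner_Integration.integral_cong) (auto simp: indicator_def)
  also have "\<dots> = \<P>(\<omega> in M. A i j \<omega> = 1)" by simp
  finally show ?thesis using prob_adj[OF assms] by simp
qed

lemma node_degree_measurable:
  assumes "i \<in> {1..n}"
  shows "node_degree n A i \<in> borel_measurable M"
proof -
  have "(\<lambda>\<omega>. \<Sum>j\<in>{1..n} - {i}. A i j \<omega>) \<in> borel_measurable M"
    using assms adj_measurable
    by (intro borel_measurable_sum) (auto simp: measurable_cong_sets[OF refl sets_borel_eq_count_space])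
  then show ?thesis
    by (simp add: node_degree_def[abs_def])
qed

section \<open>Comparing two degrees\<close>

lemma degree_diff:
  assumes "i \<in> {1..n}" "j \<in> {1..n}" "i \<noteq> j" "\<omega> \<in> space M"
  shows "real (node_degree n A i \<omega>) - real (node_degree n A j \<omega>) =
    (\<Sum>k\<in>{1..n} - {i, j}. real (A i k \<omega>)) - (\<Sum>k\<in>{1..n} - {i, j}. real (A j k \<omega>))"
proof -
  have remove: "node_degree n A u \<omega> = A u v \<omega> + (\<Sum>k\<in>{1..n} - {u} - {v}. A u k \<omega>)"
    if "v \<in> {1..n} - {u}" for u v
    unfolding node_degree_def using that by (intro sum.remove) auto
  have "node_degree n A i \<omega> = A i j \<omega> + (\<Sum>k\<in>{1..n} - {i, j}. A i k \<omega>)"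
    using remove[of j i] assms by (simp only: Diff_insert2[symmetric]) auto
  moreover have "node_degree n A j \<omega> = A j i \<omega> + (\<Sum>k\<in>{1..n} - {i, j}. A j k \<omega>)"
    using remove[of i j] assms by (simp only: Diff_insert[symmetric]) auto
  ultimately show ?thesis
    by (simp only: adj_sym[OF assms(1,2,4)]) simp
qed

text \<open>Hoeffding's inequality is applied to the edges that join exactly one of \<open>i\<close> and \<open>j\<close> to a third
  node, with sign \<open>+1\<close> for the edges at \<open>i\<close> and \<open>-1\<close> for those at \<open>j\<close>. Each signed entry ranges over
  an interval of length \<open>1\<close>.\<close>

lemma prob_degree_le:
  assumes "n \<ge> 3" and ij: "i \<in> {1..n}" "j \<in> {1..n}" "i \<noteq> j" and "0 \<le> \<delta>"
    and gap: "\<And>k. k \<in> {1..n} - {i, j} \<Longrightarrow> \<delta> \<le> edge_prob \<mu> \<beta> i k - edge_prob \<mu> \<beta> j k"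
  shows "\<P>(\<omega> in M. node_degree n A i \<omega> \<le> node_degree n A j \<omega>) \<le> exp (- ((real n - 2) * \<delta>\<^sup>2))"
proof -
  define K where "K = {1..n} - {i, j}"
  \<comment> \<open>Independence is given for the entries above the diagonal, so each edge is named by its
    ordered pair of endpoints.\<close>
  define edge where "edge = (\<lambda>(v :: nat, k). (min v k, max v k))"
  define I where "I = edge ` ({i, j} \<times> K)"
  define s :: "nat \<times> nat \<Rightarrow> real" where "s = (\<lambda>(a, b). if a = i \<or> b = i then 1 else - 1)"
  define X where "X = (\<lambda>e \<omega>. s e * real (case e of (a, b) \<Rightarrow> A a b \<omega>))"
  have cardK: "real (card K) = real n - 2"
    using ij \<open>n \<ge> 3\<close> by (simp add: K_def card_Diff_subset of_nat_diff)
  have inj: "inj_on edge ({i, j} \<times> K)"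
    by (auto simp: inj_on_def edge_def K_def min_def max_def split: if_splits)
  have I_sub: "I \<subseteq> {(a, b). 1 \<le> a \<and> a < b \<and> b \<le> n}"
    using ij by (auto simp: I_def edge_def K_def min_def max_def split: if_splits)
  have X_edge: "X (edge (v, k)) \<omega> = (if v = i then 1 else - 1) * real (A v k \<omega>)"
    if "v \<in> {i, j}" "k \<in> K" "\<omega> \<in> space M" for v k \<omega>
    using that ij adj_sym[of k v \<omega>]
    by (auto simp: X_def s_def edge_def K_def min_def max_def)
  have sum_I: "(\<Sum>e\<in>I. g e) = (\<Sum>k\<in>K. g (edge (i, k))) + (\<Sum>k\<in>K. g (edge (j, k)))"
    for g :: "nat \<times> nat \<Rightarrow> real"
    unfolding I_def using \<open>i \<noteq> j\<close>
    by (simp add: sum.reindex[OF inj] sum.cartesian_product')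
  define m where "m = (\<Sum>e\<in>I. expectation (X e))"
  interpret Hoeffding_ineq M I X
    "\<lambda>e. if s e = 1 then 0 else - 1" "\<lambda>e. if s e = 1 then 1 else 0" m
  proof unfold_locales
    show "finite I" by (simp add: I_def K_def)
    show "indep_vars (\<lambda>_. borel) X I"
      unfolding X_def
    proof (rule indep_vars_compose2[where M' = "\<lambda>_. count_space UNIV" and Y = "\<lambda>e x. s e * real x"])
      show "indep_vars (\<lambda>_. count_space UNIV) (\<lambda>e \<omega>. case e of (a, b) \<Rightarrow> A a b \<omega>) I"
        using indep_vars_subset[OF adj_indep I_sub]
        by (rule indep_vars_cong[THEN iffD1, rotated -1]) (auto split: prod.split)
    qed simp
    fix e assume "e \<in> I"
    show "AE \<omega> in M. X e \<omega> \<in> {if s e = 1 then 0 else - 1..if s e = 1 then 1 else 0}"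
    proof (rule AE_I2)
      fix \<omega> assume "\<omega> \<in> space M"
      obtain a b where e: "e = (a, b)" by fastforce
      then have "A a b \<omega> \<in> {0, 1}"
        using I_sub \<open>e \<in> I\<close> \<open>\<omega> \<in> space M\<close> by (intro adj_binary) auto
      then show "X e \<omega> \<in> {if s e = 1 then 0 else - 1..if s e = 1 then 1 else 0}"
        by (auto simp: X_def s_def e)
    qed
  next
    show "m \<equiv> \<Sum>e\<in>I. expectation (X e)" by (simp add: m_def)
  qed
  have "expectation (X (edge (v, k))) = (if v = i then 1 else - 1) * edge_prob \<mu> \<beta> v k"
    if "v \<in> {i, j}" "k \<in> K" for v k
  proof -
    have "expectation (X (edge (v, k))) =
        expectation (\<lambda>\<omega>. (if v = i then 1 else - 1) * real (A v k \<omega>))"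
      using X_edge[OF that] by (intro Bochner_Integration.integral_cong) auto
    also have "\<dots> = (if v = i then 1 else - 1) * edge_prob \<mu> \<beta> v k"
      using that ij by (simp add: expectation_adj K_def) (auto simp: expectation_adj)
    finally show ?thesis .
  qed
  then have "m = (\<Sum>k\<in>K. edge_prob \<mu> \<beta> i k - edge_prob \<mu> \<beta> j k)"
    using \<open>i \<noteq> j\<close> by (simp add: m_def sum_I sum_subtractf sum_negf)
  also have "\<dots> \<ge> (real n - 2) * \<delta>"
    using sum_mono[of K "\<lambda>_. \<delta>"] gap cardK by (simp add: K_def)
  finally have m: "(real n - 2) * \<delta> \<le> m" .
  have sum_sq: "(\<Sum>e\<in>I. ((if s e = 1 then 1 else 0) - (if s e = 1 then 0 else - 1 :: real))\<^sup>2) =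
      2 * (real n - 2)"
  proof -
    have "(\<Sum>e\<in>I. ((if s e = 1 then 1 else 0) - (if s e = 1 then 0 else - 1 :: real))\<^sup>2) = (\<Sum>e\<in>I. 1)"
      by (intro sum.cong) auto
    then show ?thesis by (simp only: sum_I) (simp add: cardK)
  qed
  have diff: "(\<Sum>e\<in>I. X e \<omega>) = real (node_degree n A i \<omega>) - real (node_degree n A j \<omega>)"
    if "\<omega> \<in> space M" for \<omega>
    using degree_diff[OF ij that] X_edge that \<open>i \<noteq> j\<close> by (simp add: sum_I sum_negf K_def)
  \<comment> \<open>The threshold \<open>m - (n - 2) \<delta>\<close> is nonnegative, whereas \<open>d\<^sub>i \<le> d\<^sub>j\<close> makes the signed sum at
    most \<open>0\<close>.\<close>
  have "\<P>(\<omega> in M. node_degree n A i \<omega> \<le> node_degree n A j \<omega>) \<le>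
      \<P>(\<omega> in M. (\<Sum>e\<in>I. X e \<omega>) \<le> m - (real n - 2) * \<delta>)"
  proof (rule finite_measure_mono)
    show "{\<omega> \<in> space M. node_degree n A i \<omega> \<le> node_degree n A j \<omega>} \<subseteq>
        {\<omega> \<in> space M. (\<Sum>e\<in>I. X e \<omega>) \<le> m - (real n - 2) * \<delta>}"
      using m diff by auto
    show "{\<omega> \<in> space M. (\<Sum>e\<in>I. X e \<omega>) \<le> m - (real n - 2) * \<delta>} \<in> events"
      by measurable
  qed
  also have "\<dots> \<le> exp (- 2 * ((real n - 2) * \<delta>)\<^sup>2 / (2 * (real n - 2)))"
    using Hoeffding_ineq_le[of "(real n - 2) * \<delta>"] sum_sq \<open>n \<ge> 3\<close> \<open>0 \<le> \<delta>\<close> by simp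
  also have "- 2 * ((real n - 2) * \<delta>)\<^sup>2 / (2 * (real n - 2)) = - ((real n - 2) * \<delta>\<^sup>2)"
    using \<open>n \<ge> 3\<close> by (simp add: power2_eq_square field_simps)
  finally show ?thesis .
qed

section \<open>Separating the support by degrees\<close>

text \<open>A node with parameter \<open>0\<close> exists because the smallest parameter is \<open>0\<close>. Hence the maximum
  degree below is over a nonempty set, and the support has at most \<open>n - 1\<close> elements.\<close>

lemma off_support_nonempty:
  assumes "n > 0"
  shows "{1..n} - beta_support n \<beta> \<noteq> {}"
proof -
  have "Min (\<beta> ` {1..n}) \<in> \<beta> ` {1..n}" using assms by (intro Min_in) auto
  then show ?thesis using beta_Min by (auto simp: beta_support_def)
qed

lemma prob_min_degree_gt:
  assumes "finite S" "finite T" "S \<subseteq> {1..n}" "T \<subseteq> {1..n}" "T \<noteq> {}"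
    and bound: "\<And>i j. i \<in> S \<Longrightarrow> j \<in> T \<Longrightarrow>
      \<P>(\<omega> in M. node_degree n A i \<omega> \<le> node_degree n A j \<omega>) \<le> q"
  shows "1 - real (card S * card T) * q \<le>
    \<P>(\<omega> in M. enat (Max ((\<lambda>j. node_degree n A j \<omega>) ` T)) < min_degree n A S \<omega>)"
proof -
  define bad where "bad = (\<lambda>(i, j). {\<omega> \<in> space M. node_degree n A i \<omega> \<le> node_degree n A j \<omega>})"
  have bad_events: "bad p \<in> events" if "p \<in> S \<times> T" for p
  proof -
    have "node_degree n A (fst p) \<in> borel_measurable M" "node_degree n A (snd p) \<in> borel_measurable M"
      using that assms by (auto intro!: node_degree_measurable)
    then show ?thesis unfolding bad_def case_prod_beta by (rule borel_measurable_le)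
  qed
  have good: "{\<omega> \<in> space M. enat (Max ((\<lambda>j. node_degree n A j \<omega>) ` T)) < min_degree n A S \<omega>} =
      space M - (\<Union>p\<in>S \<times> T. bad p)"
  proof (cases "S = {}")
    case True
    \<comment> \<open>The minimum over the empty set is \<open>\<infinity>\<close>.\<close>
    then show ?thesis by (simp add: min_degree_def top_enat_def)
  next
    case False
    have "enat (Max ((\<lambda>j. node_degree n A j \<omega>) ` T)) < min_degree n A S \<omega> \<longleftrightarrow>
        (\<forall>i\<in>S. \<forall>j\<in>T. node_degree n A j \<omega> < node_degree n A i \<omega>)" for \<omega>
      using assms False by (subst min_degree_eq_Min) auto
    then show ?thesis by (auto simp: bad_def simp flip: not_less)
  qed
  have "prob (\<Union>p\<in>S \<times> T. bad p) \<le> (\<Sum>p\<in>S \<times> T. prob (bad p))"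
    using assms bad_events by (intro finite_measure_subadditive_finite) auto
  also have "\<dots> \<le> real (card (S \<times> T)) * q"
    using bound by (intro sum_bounded_above) (auto simp: bad_def)
  finally have "prob (\<Union>p\<in>S \<times> T. bad p) \<le> real (card S * card T) * q"
    by (simp add: card_cartesian_product)
  moreover have "(\<Union>p\<in>S \<times> T. bad p) \<in> events"
    using assms bad_events by (intro sets.finite_UN) auto
  ultimately show ?thesis unfolding good by (simp add: prob_compl)
qed

end

lemma c_const_nonneg:
  assumes "n \<ge> 3" "0 < t" "t < 1"
  shows "0 \<le> c_const n t"
  using assms by (simp add: c_const_def)

text \<open>The constant \<open>c_const n t\<close> is chosen so that the Hoeffding bound equals \<open>(t / 2)\<^sup>2\<close>.\<close>

lemma exp_c_const_le:
  assumes "n \<ge> 3" "0 < t" "t < 1"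
  shows "exp (- ((real n - 2) * (c_const n t)\<^sup>2)) \<le> t"
proof -
  have "ln (2 / t) \<ge> 0" using assms by simp
  then have "(real n - 2) * (c_const n t)\<^sup>2 = 2 * ln (2 / t)"
    using assms by (simp add: c_const_def)
  then have "exp (- ((real n - 2) * (c_const n t)\<^sup>2)) = (inverse (exp (ln (2 / t))))\<^sup>2"
    by (simp add: exp_minus exp_double power_inverse)
  also have "\<dots> = (t / 2)\<^sup>2" using assms by simp
  also have "\<dots> \<le> t"
    using assms by (simp add: power2_eq_square)
  finally show ?thesis .
qed

theorem corollary2:
  fixes M :: "'a measure" and n :: nat and \<mu>0 \<tau> :: real and \<beta>0 :: "nat \<Rightarrow> real"
    and A :: "nat \<Rightarrow> nat \<Rightarrow> 'a \<Rightarrow> nat" and S Sc :: "nat set" and \<beta>_bar \<mu>_plus \<mu>_minus :: real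
  assumes "n \<ge> 3"
    and "sparse_beta_model M n \<mu>0 \<beta>0 A"
    and "0 < \<tau>" and "\<tau> < 1"
  defines "S \<equiv> beta_support n \<beta>0"
    and "Sc \<equiv> {1..n} - S"
    and "\<beta>_bar \<equiv> Max (\<beta>0 ` {1..n})"
    and "\<mu>_plus \<equiv> max \<mu>0 0"
    and "\<mu>_minus \<equiv> max (- \<mu>0) 0"
  assumes "min_beta \<beta>0 S >
      ereal (ln (1 + c_const n (\<tau> / (real n * (real n - 1)))
                   * (1 + exp \<mu>_minus) * (1 + exp (2 * \<beta>_bar + \<mu>_plus))))"
  shows "\<P>(\<omega> in M. min_degree n A S \<omega> > enat (Max ((\<lambda>j. node_degree n A j \<omega>) ` Sc))) \<ge> 1 - \<tau>"
proof -
  interpret sparse_beta_model M n \<mu>0 \<beta>0 A by fact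
  define t where "t = \<tau> / (real n * (real n - 1))"
  have nn: "real n * (real n - 1) \<ge> 1"
    using \<open>n \<ge> 3\<close> mult_mono[of 1 "real n" 1 "real n - 1"] by simp
  have t: "0 < t" "t < 1"
    using \<open>0 < \<tau>\<close> \<open>\<tau> < 1\<close> nn by (auto simp: t_def divide_less_eq)
  have fin: "finite S" "finite Sc" and sub: "S \<subseteq> {1..n}" "Sc \<subseteq> {1..n}"
    by (auto simp: S_def Sc_def beta_support_def)
  have Sc_ne: "Sc \<noteq> {}" using off_support_nonempty \<open>n \<ge> 3\<close> by (simp add: Sc_def S_def)
  have gap: "c_const n t \<le> edge_prob \<mu>0 \<beta>0 i k - edge_prob \<mu>0 \<beta>0 j k"
    if "i \<in> S" "j \<in> Sc" "k \<in> {1..n}" for i j k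
  proof (rule edge_prob_gap[where B = \<beta>_bar])
    have "min_beta \<beta>0 S \<le> ereal (\<beta>0 i)" unfolding min_beta_def using \<open>i \<in> S\<close> by (rule INF_lower)
    then show "ln (1 + c_const n t * (1 + exp (max (- \<mu>0) 0)) * (1 + exp (2 * \<beta>_bar + max \<mu>0 0)))
        < \<beta>0 i"
      using assms(10) unfolding t_def \<mu>_plus_def \<mu>_minus_def
      by (metis less_le_trans less_ereal.simps(1))
    show "\<beta>0 j = 0" using \<open>j \<in> Sc\<close> by (auto simp: Sc_def S_def beta_support_def)
  qed (use that sub beta_nonneg c_const_nonneg[OF \<open>n \<ge> 3\<close> t] in \<open>auto simp: \<beta>_bar_def\<close>)
  have pair: "\<P>(\<omega> in M. node_degree n A i \<omega> \<le> node_degree n A j \<omega>) \<le> t"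
    if "i \<in> S" "j \<in> Sc" for i j
  proof -
    have "\<P>(\<omega> in M. node_degree n A i \<omega> \<le> node_degree n A j \<omega>) \<le>
        exp (- ((real n - 2) * (c_const n t)\<^sup>2))"
      using that sub gap[OF that] c_const_nonneg[OF \<open>n \<ge> 3\<close> t]
      by (intro prob_degree_le \<open>n \<ge> 3\<close>) (auto simp: Sc_def)
    also have "\<dots> \<le> t" using \<open>n \<ge> 3\<close> t by (rule exp_c_const_le)
    finally show ?thesis .
  qed
  have "real (card S * card Sc) * t \<le> real n * (real n - 1) * t"
  proof -
    have "S \<subset> {1..n}" using sub Sc_ne by (auto simp: Sc_def)
    then have "card S \<le> n - 1" using psubset_card_mono[of "{1..n}" S] by simp
    moreover have "card Sc \<le> n" using card_mono[OF _ sub(2)] by simp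
    ultimately have "card S * card Sc \<le> (n - 1) * n" by (rule mult_le_mono)
    then have "real (card S * card Sc) \<le> real ((n - 1) * n)" by (simp only: of_nat_le_iff)
    also have "\<dots> = real n * (real n - 1)" using \<open>n \<ge> 3\<close> by (simp add: of_nat_diff)
    finally show ?thesis using t by (intro mult_right_mono) auto
  qed
  also have "\<dots> = \<tau>" using \<open>n \<ge> 3\<close> by (simp add: t_def)
  finally show ?thesis
    using prob_min_degree_gt[OF fin sub Sc_ne pair] by linarith
qed

end
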